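(* Consider the Distributed Tracking problem with $k$ players and threshold $N$ under the multinomial arrival model with known probabilities $\mu_1,\dots,\mu_k$, and let $\delta\in(0,1)$. With probability $1-\delta'$, where $\delta'=\delta\cdot O(\log\log N)$, the algorithm $\mathit{StcSlk\text{-}KwnDst}$ (described in the context): (i) runs at most $O\!\left(\log\log \frac{N}{k\log\frac{k}{\delta}}+\log\log\frac{k}{\delta}\right)$ rounds; and (ii) has total communication cost $O\!\left(k\log\log \frac{N}{k\log\frac{k}{\delta}}+k\log\log\frac{k}{\delta}\right)$.
   Context: Distributed Tracking (DT) problem: there is a coordinator and $k$ players, each player connected to the coordinator by a two-way channel. The coordinator holds a positive integer threshold $N$; player $i\in[k]=\{1,\dots,k\}$ holds a counter $n_i$, initially $0$. Items arrive one at a time (at most one per time stamp); each arriving item increments the counter of exactly one player. The coordinator must raise an alarm at exactly the moment the $N$-th item arrives, i.e. when $\sum_i n_i$ (summed over the whole execution) reaches $N$. The communication cost is the total number of messages sent or received by the coordinator, each message carrying $O(1)$ words. Multinomial arrival model: independently for each item, the item arrives at player $i$ with probability $\mu_i$, where $\mu_i\ge 0$ and $\sum_{i=1}^k\mu_i=1$; here the $\mu_i$ are known to the algorithm. $\ln$ is the natural logarithm. Straightforward algorithm: each player sends a message to the coordinator for every increment of its counter. CMY algorithm (run with current threshold $N$, in rounds): if $N<4k$, run the straightforward algorithm; otherwise the coordinator sends slack $s=\lfloor N/(2k)\rfloor$ to every player, each player notifies the coordinator whenever its counter has increased by $s$ since its last communication with the coordinator, and upon the $k$-th notification the coordinator collects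 all counters, sets $N\leftarrow N-\sum_i n_i$, raises the alarm if $N=0$, and otherwise starts a new round with this $N$ and counters reset to $0$. Algorithm $\mathit{StcSlk\text{-}KwnDst}$ runs in rounds. At the start of each round with current threshold $N$: all counters are reset to $0$; if $N\le 4k$, run the straightforward algorithm until termination; else if $N\le\beta k\ln\frac{k}{\delta}$ with $\beta=2(\sqrt2+2/3)^2$, run the CMY algorithm until termination; otherwise set $t=N-(\sqrt2+\frac23)\sqrt{kN\ln\frac{k}{\delta}}$, the coordinator sends to each player $i$ the slack $s_i=\mu_i t+\sqrt{2t\mu_i(1-\mu_i)\ln\frac{k}{\delta}}+\frac23\ln\frac{k}{\delta}$, player $i$ notifies the coordinator when $n_i$ reaches $s_i$, and upon receiving the first notification the coordinator collects all $n_i$, sets $N\leftarrow N-\sum_i n_i$, raises the alarm and terminates if $N=0$, and otherwise starts a new round. *)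

theory Defs
  imports "HOL-Probability.Probability"
begin

text \<open>
  The protocol is a state machine that consumes the arriving items one at a time; an item is
  represented by the player in \<open>{1..k}\<close> at which it arrives. \<open>Static\<close> is the phase in which the
  players hold the distribution-dependent slacks, and \<open>Alarm\<close> the terminal phase, in which further
  items are ignored.
\<close>

datatype phase = Straight | Cmy | Static | Alarm

text \<open>
  \<open>thr\<close> is the threshold \<open>N\<close> of the current round and \<open>cnt i\<close> is \<open>n\<^sub>i\<close>, counted from the start of that
  round. \<open>reported i\<close> is the value of \<open>cnt i\<close> at the last communication of player \<open>i\<close> and \<open>notif\<close> the
  number of notifications in the current round (both are used by the CMY rounds only).
  \<open>rounds\<close> and \<open>msgs\<close> count the rounds started, of whichever phase, and the messages sent or
  received by the coordinator, over the whole execution.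
\<close>

record dt_state =
  phase :: phase
  thr :: nat
  cnt :: "nat \<Rightarrow> nat"
  reported :: "nat \<Rightarrow> nat"
  notif :: nat
  rounds :: nat
  msgs :: nat

text \<open>
  Every round is charged \<open>k\<close> messages for its announcement, which resets the counters and carries the
  slack if there is one. The straightforward phase is charged too, since the players have to learn
  that it begins.
\<close>

definition begin_round :: "nat \<Rightarrow> phase \<Rightarrow> dt_state \<Rightarrow> dt_state" where
  "begin_round k p st = st\<lparr>phase := p, cnt := (\<lambda>_. 0), reported := (\<lambda>_. 0), notif := 0,
     rounds := rounds st + 1, msgs := msgs st + k\<rparr>"

definition begin_cmy :: "nat \<Rightarrow> dt_state \<Rightarrow> dt_state" where
  "begin_cmy k st = begin_round k (if thr st < 4 * k then Straight else Cmy) st"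

definition beta :: real where
  "beta = 2 * (sqrt 2 + 2 / 3)\<^sup>2"

definition begin_main :: "nat \<Rightarrow> real \<Rightarrow> dt_state \<Rightarrow> dt_state" where
  "begin_main k \<delta> st =
     (if thr st \<le> 4 * k then begin_round k Straight st
      else if real (thr st) \<le> beta * real k * ln (real k / \<delta>) then begin_cmy k st
      else begin_round k Static st)"

text \<open>
  Collecting the counters costs a request to and a reply from every player.
  The argument \<open>start\<close> begins the following round if the threshold is not exhausted.
\<close>

definition end_round :: "nat \<Rightarrow> (dt_state \<Rightarrow> dt_state) \<Rightarrow> dt_state \<Rightarrow> dt_state" where
  "end_round k start st =
     (let st' = st\<lparr>thr := thr st - (\<Sum>i=1..k. cnt st i), msgs := msgs st + 2 * k\<rparr>
      in if thr st' = 0 then st'\<lparr>phase := Alarm\<rparr> else start st')"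

definition cmy_slack :: "nat \<Rightarrow> nat \<Rightarrow> nat" where
  "cmy_slack k N = N div (2 * k)"

definition static_target :: "nat \<Rightarrow> real \<Rightarrow> nat \<Rightarrow> real" where
  "static_target k \<delta> N = real N - (sqrt 2 + 2 / 3) * sqrt (real k * real N * ln (real k / \<delta>))"

definition static_slack :: "nat \<Rightarrow> real \<Rightarrow> nat pmf \<Rightarrow> nat \<Rightarrow> nat \<Rightarrow> real" where
  "static_slack k \<delta> \<mu> N i =
     (let t = static_target k \<delta> N
      in pmf \<mu> i * t + sqrt (2 * t * pmf \<mu> i * (1 - pmf \<mu> i) * ln (real k / \<delta>))
           + 2 / 3 * ln (real k / \<delta>))"

definition dt_step :: "nat \<Rightarrow> real \<Rightarrow> nat pmf \<Rightarrow> dt_state \<Rightarrow> nat \<Rightarrow> dt_state" where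
  "dt_step k \<delta> \<mu> st i =
     (let st1 = st\<lparr>cnt := (cnt st)(i := cnt st i + 1)\<rparr>
      in case phase st of
           Alarm \<Rightarrow> st
         | Straight \<Rightarrow>
             (let st2 = st1\<lparr>msgs := msgs st + 1\<rparr>
              in if (\<Sum>j=1..k. cnt st2 j) = thr st then st2\<lparr>phase := Alarm\<rparr> else st2)
         | Cmy \<Rightarrow>
             (if cnt st1 i - reported st i \<ge> cmy_slack k (thr st)
              then (let st2 = st1\<lparr>reported := (reported st)(i := cnt st1 i),
                                  notif := notif st + 1, msgs := msgs st + 1\<rparr>
                    in if notif st2 = k then end_round k (begin_cmy k) st2 else st2)
              else st1)
         | Static \<Rightarrow>
             (if real (cnt st1 i) \<ge> static_slack k \<delta> \<mu> (thr st) i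
              then end_round k (begin_main k \<delta>) (st1\<lparr>msgs := msgs st + 1\<rparr>)
              else st1))"

definition stc_slk_kwn_dst :: "nat \<Rightarrow> real \<Rightarrow> nat pmf \<Rightarrow> nat \<Rightarrow> nat list \<Rightarrow> dt_state" where
  "stc_slk_kwn_dst k \<delta> \<mu> N xs =
     foldl (dt_step k \<delta> \<mu>)
       (begin_main k \<delta>
         \<lparr>phase = Static, thr = N, cnt = (\<lambda>_. 0), reported = (\<lambda>_. 0), notif = 0,
          rounds = 0, msgs = 0\<rparr>) xs"

text \<open>
  \<open>log log\<close> as it is read inside \<open>O(\<dots>)\<close>: equal to \<open>ln (ln x)\<close> for \<open>x \<ge> e\<^sup>e\<close> and equal to \<open>1\<close> for
  smaller \<open>x\<close>, where the iterated logarithm is below \<open>1\<close> (possibly negative) or undefined.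
\<close>

definition loglog :: "real \<Rightarrow> real" where
  "loglog x = ln (ln (max x (exp (exp 1))))"


section \<open>The alarm is raised exactly with the last item\<close>

text \<open>
  The facts below are not needed to state the main result. They justify reading off the number
  of rounds and the communication cost after \<open>N\<close> items.
\<close>

definition dt_inv :: "nat \<Rightarrow> real \<Rightarrow> nat pmf \<Rightarrow> nat \<Rightarrow> nat \<Rightarrow> dt_state \<Rightarrow> bool" where
  "dt_inv k \<delta> \<mu> N m st \<longleftrightarrow>
     (phase st = Alarm \<and> m = N) \<or>
     (phase st \<noteq> Alarm \<and> m + thr st = N + (\<Sum>i=1..k. cnt st i) \<and> (\<Sum>i=1..k. cnt st i) < thr st \<and>
      (phase st = Cmy \<longrightarrow> 4 * k \<le> thr st \<and> notif st < k \<and>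
         (\<Sum>i=1..k. reported st i) = notif st * cmy_slack k (thr st) \<and>
         (\<forall>i\<in>{1..k}. reported st i \<le> cnt st i \<and> cnt st i < reported st i + cmy_slack k (thr st))) \<and>
      (phase st = Static \<longrightarrow> real (thr st) > beta * real k * ln (real k / \<delta>) \<and>
         (\<forall>i\<in>{1..k}. real (cnt st i) < static_slack k \<delta> \<mu> (thr st) i)))"

lemma sum_upd:
  fixes f :: "nat \<Rightarrow> nat"
  assumes "i \<in> {1..k}"
  shows "(\<Sum>j=1..k. (f(i := v)) j) + f i = (\<Sum>j=1..k. f j) + v"
proof -
  have "(\<Sum>j=1..k. (f(i := v)) j) = v + (\<Sum>j\<in>{1..k} - {i}. (f(i := v)) j)"
    using assms by (subst sum.remove[of _ i]) auto
  also have "(\<Sum>j\<in>{1..k} - {i}. (f(i := v)) j) = (\<Sum>j\<in>{1..k} - {i}. f j)"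
    by (rule sum.cong) auto
  finally show ?thesis using sum.remove[of "{1..k}" i f] assms by auto
qed

context
  fixes k :: nat and \<delta> :: real and \<mu> :: "nat pmf" and N :: nat
  assumes k: "1 \<le> k" and \<delta>: "0 < \<delta>" "\<delta> < 1" and \<mu>: "set_pmf \<mu> \<subseteq> {1..k}"
begin

lemma L_pos: "0 < ln (real k / \<delta>)"
  using k \<delta> by (intro ln_gt_zero) (auto simp: field_simps)

lemma static_target_pos:
  assumes "real M > beta * real k * ln (real k / \<delta>)"
  shows "0 < static_target k \<delta> M" "real k * ln (real k / \<delta>) \<le> real M"
proof -
  define c where "c = sqrt 2 + (2 / 3 :: real)"
  define K where "K = real k * ln (real k / \<delta>)"
  have c: "c \<ge> 1" unfolding c_def by (smt (verit) real_sqrt_ge_1_iff divide_nonneg_nonneg)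
  have K: "K > 0" unfolding K_def using L_pos k by auto
  have M: "real M > 2 * c\<^sup>2 * K" using assms by (simp add: beta_def c_def K_def mult.assoc)
  have c2: "c\<^sup>2 \<ge> 1" using c by simp
  have cK: "c\<^sup>2 * K \<ge> K" using c2 K by simp
  then have KM: "K < real M" using M K by linarith
  have "c\<^sup>2 * K * real M < real M * real M"
    using M K c2 by (intro mult_strict_right_mono) (use cK KM in linarith)+
  then have "(c * sqrt (K * real M))\<^sup>2 < (real M)\<^sup>2"
    using K by (simp add: power_mult_distrib) (simp add: power2_eq_square mult.assoc)
  then have "c * sqrt (K * real M) < real M"
    by (rule power_less_imp_less_base) auto
  then show "0 < static_target k \<delta> M"
    by (simp add: static_target_def c_def K_def mult.assoc mult.commute mult.left_commute)
  show "real k * ln (real k / \<delta>) \<le> real M" using KM K_def by simp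
qed

lemma static_slack_pos:
  assumes "real M > beta * real k * ln (real k / \<delta>)"
  shows "0 < static_slack k \<delta> \<mu> M i"
proof -
  note t = static_target_pos[OF assms]
  have "0 \<le> pmf \<mu> i * static_target k \<delta> M" using t by auto
  moreover have "0 \<le> sqrt (2 * static_target k \<delta> M * pmf \<mu> i * (1 - pmf \<mu> i) * ln (real k / \<delta>))"
    using t L_pos by (simp add: pmf_le_1)
  ultimately show ?thesis using L_pos unfolding static_slack_def Let_def by linarith
qed

lemma sum_static_slack_le:
  assumes M: "real M > beta * real k * ln (real k / \<delta>)"
  shows "(\<Sum>i=1..k. static_slack k \<delta> \<mu> M i) \<le> real M"
proof -
  define L where "L = ln (real k / \<delta>)"
  define t where "t = static_target k \<delta> M"
  have L: "0 < L" using L_pos by (simp add: L_def)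
  have t: "0 < t" and KM: "real k * L \<le> real M" using static_target_pos[OF M] by (auto simp: t_def L_def)
  have tM: "t \<le> real M" unfolding t_def static_target_def using L L_def by simp
  have s1: "(\<Sum>i=1..k. pmf \<mu> i) = 1" using \<mu> by (intro sum_pmf_eq_1) auto
  have "(\<Sum>i=1..k. sqrt (pmf \<mu> i * (1 - pmf \<mu> i))) \<le> (\<Sum>i=1..k. \<bar>1\<bar> * \<bar>sqrt (pmf \<mu> i)\<bar>)"
    by (intro sum_mono) (auto simp: real_sqrt_mult pmf_le_1 intro!: mult_left_le)
  also have "\<dots> \<le> L2_set (\<lambda>_. 1) {1..k} * L2_set (\<lambda>i. sqrt (pmf \<mu> i)) {1..k}"
    by (rule L2_set_mult_ineq)
  also have "\<dots> = sqrt k"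
    using s1 by (simp add: L2_set_def)
  finally have cs: "(\<Sum>i=1..k. sqrt (pmf \<mu> i * (1 - pmf \<mu> i))) \<le> sqrt k" .
  have "(\<Sum>i=1..k. static_slack k \<delta> \<mu> M i) =
      (\<Sum>i=1..k. pmf \<mu> i * t + sqrt (2 * t * L) * sqrt (pmf \<mu> i * (1 - pmf \<mu> i)) + 2 / 3 * L)"
    by (rule sum.cong) (auto simp: static_slack_def Let_def t_def L_def real_sqrt_mult mult_ac)
  also have "\<dots> = (\<Sum>i=1..k. pmf \<mu> i) * t
      + sqrt (2 * t * L) * (\<Sum>i=1..k. sqrt (pmf \<mu> i * (1 - pmf \<mu> i))) + 2 / 3 * (real k * L)"
    by (simp add: sum.distrib sum_distrib_left sum_distrib_right)
  also have "\<dots> \<le> t + sqrt (2 * real M * L) * sqrt k + 2 / 3 * (real k * L)"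
    using cs tM t L s1 by (intro add_mono mult_mono) (auto intro!: sum_nonneg simp: pmf_le_1)
  also have "sqrt (2 * real M * L) * sqrt k = sqrt 2 * sqrt (real k * real M * L)"
    by (simp add: real_sqrt_mult mult_ac)
  also have "real k * L \<le> sqrt (real k * real M * L)"
  proof (rule real_le_rsqrt)
    have "(real k * L) * (real k * L) \<le> (real k * L) * real M"
      using KM L by (intro mult_left_mono) auto
    then show "(real k * L)\<^sup>2 \<le> real k * real M * L" by (simp add: power2_eq_square mult_ac)
  qed
  finally show ?thesis
    by (simp add: t_def static_target_def L_def algebra_simps)
qed

lemma dt_inv_begin_cmy:
  assumes "m + thr st = N" "0 < thr st"
  shows "dt_inv k \<delta> \<mu> N m (begin_cmy k st)"
  using assms k
  by (auto simp: dt_inv_def begin_cmy_def begin_round_def cmy_slack_def div_greater_zero_iff)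

lemma dt_inv_begin_main:
  assumes "m + thr st = N" "0 < thr st"
  shows "dt_inv k \<delta> \<mu> N m (begin_main k \<delta> st)"
  using assms dt_inv_begin_cmy[OF assms] static_slack_pos[of "thr st"]
  by (auto simp: begin_main_def) (auto simp: dt_inv_def begin_round_def)

lemma dt_inv_end_round:
  assumes "m + thr st = N + (\<Sum>i=1..k. cnt st i)" "(\<Sum>i=1..k. cnt st i) \<le> thr st"
    and "\<And>st'. m + thr st' = N \<Longrightarrow> 0 < thr st' \<Longrightarrow> dt_inv k \<delta> \<mu> N m (start st')"
  shows "dt_inv k \<delta> \<mu> N m (end_round k start st)"
  using assms by (auto simp: end_round_def Let_def dt_inv_def)

lemma dt_inv_step:
  assumes inv: "dt_inv k \<delta> \<mu> N m st" and "m < N" and i: "i \<in> {1..k}"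
  shows "dt_inv k \<delta> \<mu> N (Suc m) (dt_step k \<delta> \<mu> st i)"
proof -
  define c where "c = (cnt st)(i := Suc (cnt st i))"
  have sc: "(\<Sum>j=1..k. c j) = Suc (\<Sum>j=1..k. cnt st j)"
    using sum_upd[OF i, of "cnt st" "Suc (cnt st i)"] by (simp add: c_def)
  have m: "m + thr st = N + (\<Sum>i=1..k. cnt st i)" "(\<Sum>i=1..k. cnt st i) < thr st"
    and nal: "phase st \<noteq> Alarm"
    using inv \<open>m < N\<close> by (auto simp: dt_inv_def)
  show ?thesis
  proof (cases "phase st")
    case Straight
    then show ?thesis using m sc
      by (auto simp: dt_step_def Let_def dt_inv_def c_def[symmetric])
  next
    case Static
    have I: "real (thr st) > beta * real k * ln (real k / \<delta>)"
      "\<And>i. i \<in> {1..k} \<Longrightarrow> real (cnt st i) < static_slack k \<delta> \<mu> (thr st) i"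
      using inv Static by (auto simp: dt_inv_def)
    show ?thesis
    proof (cases "real (c i) \<ge> static_slack k \<delta> \<mu> (thr st) i")
      case True
      then have "dt_step k \<delta> \<mu> st i = end_round k (begin_main k \<delta>) (st\<lparr>cnt := c, msgs := msgs st + 1\<rparr>)"
        using Static by (simp add: dt_step_def Let_def c_def)
      moreover have "dt_inv k \<delta> \<mu> N (Suc m) \<dots>"
        by (rule dt_inv_end_round) (use m sc dt_inv_begin_main in auto)
      ultimately show ?thesis by simp
    next
      case False
      have lt: "real (c j) < static_slack k \<delta> \<mu> (thr st) j" if "j \<in> {1..k}" for j
        using I(2)[OF that] False by (cases "j = i") (auto simp: c_def)
      have "real (\<Sum>j=1..k. c j) < (\<Sum>j=1..k. static_slack k \<delta> \<mu> (thr st) j)"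
        unfolding of_nat_sum using lt i by (intro sum_strict_mono) auto
      also have "\<dots> \<le> real (thr st)" by (rule sum_static_slack_le[OF I(1)])
      finally have "(\<Sum>j=1..k. c j) < thr st" by linarith
      then show ?thesis using False Static m sc lt I(1)
        by (auto simp: dt_step_def Let_def dt_inv_def c_def[symmetric])
    qed
  next
    case Cmy
    define s where "s = cmy_slack k (thr st)"
    have I: "4 * k \<le> thr st" "notif st < k" "(\<Sum>i=1..k. reported st i) = notif st * s"
      "\<And>i. i \<in> {1..k} \<Longrightarrow> reported st i \<le> cnt st i \<and> cnt st i < reported st i + s"
      using inv Cmy by (auto simp: dt_inv_def s_def)
    have s2: "2 * k * s \<le> thr st" by (simp add: s_def cmy_slack_def)
    show ?thesis
    proof (cases "c i - reported st i \<ge> s")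
      case True
      define r where "r = (reported st)(i := c i)"
      have ci: "c i = reported st i + s" using True I(4)[OF i] by (auto simp: c_def)
      have sr: "(\<Sum>j=1..k. r j) = (notif st + 1) * s"
        using sum_upd[OF i, of "reported st" "c i"] I(3) ci by (simp add: r_def)
      have s0: "0 < s" using I(4)[OF i] by auto
      have rb: "r j \<le> c j \<and> c j < r j + s" if "j \<in> {1..k}" for j
        using I(4)[OF that] s0 by (auto simp: r_def c_def)
      show ?thesis
      proof (cases "notif st + 1 = k")
        case k': True
        then have "dt_step k \<delta> \<mu> st i = end_round k (begin_cmy k)
           (st\<lparr>cnt := c, reported := r, notif := notif st + 1, msgs := msgs st + 1\<rparr>)"
          using True Cmy by (simp add: dt_step_def Let_def c_def r_def s_def)
        moreover have "dt_inv k \<delta> \<mu> N (Suc m) \<dots>"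
          by (rule dt_inv_end_round) (use m sc dt_inv_begin_cmy in auto)
        ultimately show ?thesis by simp
      next
        case nk: False
        have "(\<Sum>j=1..k. c j) < (\<Sum>j=1..k. r j + s)"
          using rb i by (intro sum_strict_mono) auto
        also have "\<dots> = (notif st + 1 + k) * s" using sr by (simp add: sum.distrib algebra_simps)
        also have "\<dots> \<le> (2 * k) * s" using I(2) by (intro mult_right_mono) auto
        finally have "(\<Sum>j=1..k. c j) < thr st" using s2 by simp
        then show ?thesis using True nk Cmy m sc rb sr I
          by (auto simp: dt_step_def Let_def dt_inv_def c_def[symmetric] r_def[symmetric] s_def[symmetric])
      qed
    next
      case False
      have rb: "reported st j \<le> c j \<and> c j < reported st j + s" if "j \<in> {1..k}" for j
        using I(4)[OF that] False by (auto simp: c_def)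
      have "(\<Sum>j=1..k. c j) < (\<Sum>j=1..k. reported st j + s)"
        using rb i by (intro sum_strict_mono) auto
      also have "\<dots> = (notif st + k) * s" using I(3) by (simp add: sum.distrib algebra_simps)
      also have "\<dots> \<le> (2 * k) * s" using I(2) by (intro mult_right_mono) auto
      finally have "(\<Sum>j=1..k. c j) < thr st" using s2 by simp
      then show ?thesis using False Cmy m sc rb I
        by (auto simp: dt_step_def Let_def dt_inv_def c_def[symmetric] s_def[symmetric])
    qed
  qed (use nal in auto)
qed

lemma alarm_iff_last_item:
  assumes "1 \<le> N" "set xs \<subseteq> {1..k}" "length xs \<le> N"
  shows "phase (stc_slk_kwn_dst k \<delta> \<mu> N xs) = Alarm \<longleftrightarrow> length xs = N"
proof -
  have "dt_inv k \<delta> \<mu> N (length xs) (stc_slk_kwn_dst k \<delta> \<mu> N xs)"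
    using assms(2,3)
  proof (induction xs rule: rev_induct)
    case Nil
    then show ?case
      using assms(1) unfolding stc_slk_kwn_dst_def by (auto intro!: dt_inv_begin_main)
  next
    case (snoc x xs)
    then show ?case
      using dt_inv_step[of "length xs" "stc_slk_kwn_dst k \<delta> \<mu> N xs" x]
      by (simp add: stc_slk_kwn_dst_def)
  qed
  then show ?thesis by (auto simp: dt_inv_def)
qed

end

end

theory Submission
  imports Defs
begin

text \<open>
  Put \<open>L = ln (k / \<delta>)\<close> and \<open>c = sqrt 2 + 2 / 3\<close>. The slacks of a static round with threshold \<open>M\<close> are
  Bernstein bounds for the counters after \<open>t = M - c * sqrt (k * M * L)\<close> items, so by a union bound
  the round outlasts these items except with probability \<open>\<delta>\<close>, and the next threshold is then at
  most \<open>c * sqrt (k * M * L)\<close>. Hence the ratio of the threshold to \<open>c\<^sup>2 * k * L\<close> is replaced by at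
  most its square root, and it falls to \<open>2\<close>, i.e. the threshold to \<open>beta * k * L\<close>, within doubly
  logarithmically many rounds. Every CMY round removes at least a quarter of the remaining threshold,
  so \<open>O(ln L)\<close> further rounds suffice, whatever the arrivals. A round costs \<open>O(k)\<close> messages.

  At the start of a round exactly \<open>thr\<close> items are still to come and they are independent of the past;
  the failure probability can therefore be bounded by induction on the number of static rounds,
  for all starting states at once.
\<close>

section \<open>Bernstein's inequality for the counters\<close>

text \<open>The estimate behind Bernstein's inequality. With \<open>l\<close> replaced by
  \<open>y\<close> and the denominator \<open>2 * (1 - y / 3)\<close> cleared, it says
  \<open>F y \<ge> 0\<close>, where \<open>F\<close> is convex with value and derivative 0 at 0, so
  it lies above its tangent there. Since \<open>y \<le> l < 3\<close>, going back to
  \<open>l\<close> only weakens the bound.\<close>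

lemma exp_le_quadratic:
  fixes y :: real
  assumes "y \<le> l" "l < 3"
  shows "exp y \<le> 1 + y + y\<^sup>2 / (2 * (1 - l / 3))"
proof -
  define F where "F = (\<lambda>y::real. 2 + 4 * y / 3 + y\<^sup>2 / 3 - (2 - 2 * y / 3) * exp y)"
  define F' where "F' = (\<lambda>y::real. 4 / 3 + 2 * y / 3 - (4 / 3 - 2 * y / 3) * exp y)"
  define F'' where "F'' = (\<lambda>y::real. 2 / 3 * (1 - (1 - y) * exp y))"
  have F: "(F has_real_derivative F' y) (at y)" for y
    unfolding F_def F'_def by (auto intro!: derivative_eq_intros simp: field_simps)
  have F': "(F' has_real_derivative F'' y) (at y)" for y
    unfolding F'_def F''_def by (auto intro!: derivative_eq_intros simp: field_simps)
  have "F'' y \<ge> 0" for y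
  proof -
    have "(1 - y) * exp y \<le> exp (- y) * exp y"
      using exp_ge_add_one_self[of "- y"] by (intro mult_right_mono) auto
    then show ?thesis by (simp add: F''_def exp_minus)
  qed
  then have "convex_on UNIV F"
    using F F' by (intro f''_ge0_imp_convex) auto
  then have "F y - F 0 \<ge> F' 0 * (y - 0)"
    using F[of 0] by (intro convex_on_imp_above_tangent[where A = UNIV]) auto
  then have "2 * (1 - y / 3) * exp y \<le> 2 * (1 - y / 3) * (1 + y) + y\<^sup>2"
    by (simp add: F_def F'_def field_simps power2_eq_square)
  then have "exp y \<le> (2 * (1 - y / 3) * (1 + y) + y\<^sup>2) / (2 * (1 - y / 3))"
    using assms by (subst pos_le_divide_eq) (auto simp: mult.commute)
  also have "\<dots> = 1 + y + y\<^sup>2 / (2 * (1 - y / 3))"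
    using assms by (simp add: add_divide_distrib)
  also have "\<dots> \<le> 1 + y + y\<^sup>2 / (2 * (1 - l / 3))"
    using assms by (intro add_left_mono divide_left_mono) auto
  finally show ?thesis .
qed

text \<open>Centre the variable: it is \<open>l * (1 - p)\<close> with probability \<open>p\<close>
  and \<open>- (l * p)\<close> otherwise, both at most \<open>l\<close>. In the quadratic bound the
  linear terms cancel, the squares add up to the variance, and \<open>1 + x \<le> exp x\<close>
  finishes.\<close>

lemma bernoulli_mgf_le:
  fixes p l :: real
  assumes "0 \<le> p" "p \<le> 1" "0 \<le> l" "l < 3"
  shows "p * exp l + (1 - p) \<le> exp (p * l + p * (1 - p) * l\<^sup>2 / (2 * (1 - l / 3)))"
proof -
  define w where "w = 1 / (2 * (1 - l / 3))"
  have "l * (1 - p) \<le> l" "- (l * p) \<le> l"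
    using assms by (auto intro: mult_left_le order_trans[of _ 0])
  then have "exp (l * (1 - p)) \<le> 1 + l * (1 - p) + (l * (1 - p))\<^sup>2 * w"
      and "exp (- (l * p)) \<le> 1 - l * p + (l * p)\<^sup>2 * w"
    using exp_le_quadratic[of "l * (1 - p)" l] exp_le_quadratic[of "- (l * p)" l] assms
    by (auto simp: w_def)
  then have "p * exp (l * (1 - p)) + (1 - p) * exp (- (l * p))
      \<le> p * (1 + l * (1 - p) + (l * (1 - p))\<^sup>2 * w) + (1 - p) * (1 - l * p + (l * p)\<^sup>2 * w)"
    using assms by (intro add_mono mult_left_mono) auto
  also have "\<dots> = 1 + p * (1 - p) * l\<^sup>2 * w"
    by (simp add: power2_eq_square algebra_simps)
  also have "\<dots> \<le> exp (p * (1 - p) * l\<^sup>2 * w)"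
    by (rule exp_ge_add_one_self)
  finally have "exp (p * l) * (p * exp (l * (1 - p)) + (1 - p) * exp (- (l * p)))
      \<le> exp (p * l) * exp (p * (1 - p) * l\<^sup>2 * w)"
    by (intro mult_left_mono) auto
  moreover have "exp (p * l) * (p * exp (l * (1 - p)) + (1 - p) * exp (- (l * p))) = p * exp l + (1 - p)"
    by (simp add: algebra_simps flip: exp_add)
  ultimately show ?thesis by (simp add: w_def exp_add)
qed

section \<open>Arrival sequences conditioned on their first items\<close>

lemma measure_bind_pmf:
  "measure_pmf.prob (bind_pmf p f) A = (\<integral>x. measure_pmf.prob (f x) A \<partial>measure_pmf p)"
proof -
  have "ennreal (measure_pmf.prob (bind_pmf p f) A) = (\<integral>\<^sup>+x. emeasure (f x) A \<partial>measure_pmf p)"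
    by (simp flip: measure_pmf.emeasure_eq_measure)
  also have "\<dots> = ennreal (\<integral>x. measure_pmf.prob (f x) A \<partial>measure_pmf p)"
    unfolding measure_pmf.emeasure_eq_measure
    by (intro nn_integral_eq_integral measure_pmf.integrable_const_bound[where B = 1]) auto
  finally show ?thesis by (simp add: integral_nonneg)
qed

lemma measure_replicate_pmf_Suc:
  "measure_pmf.prob (replicate_pmf (Suc n) p) A =
     (\<integral>x. measure_pmf.prob (replicate_pmf n p) {xs. x # xs \<in> A} \<partial>measure_pmf p)"
  by (simp add: replicate_pmf_def measure_bind_pmf vimage_def flip: map_pmf_def)

lemma measure_replicate_pmf_add:
  "measure_pmf.prob (replicate_pmf (m + n) p) A =
     (\<integral>ys. measure_pmf.prob (replicate_pmf n p) {zs. ys @ zs \<in> A} \<partial>measure_pmf (replicate_pmf m p))"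
  by (simp add: replicate_pmf_distrib measure_bind_pmf vimage_def flip: map_pmf_def)

lemma integrable_prob_pmf:
  "integrable (measure_pmf p) (\<lambda>x. measure_pmf.prob (f x) (A x))"
  by (intro measure_pmf.integrable_const_bound[where B = 1]) auto

lemma measure_replicate_pmf_Suc_le:
  assumes "\<And>x. x \<in> set_pmf p \<Longrightarrow> measure_pmf.prob (replicate_pmf n p) {xs. x # xs \<in> A} \<le> B"
  shows "measure_pmf.prob (replicate_pmf (Suc n) p) A \<le> B"
  unfolding measure_replicate_pmf_Suc
  by (intro measure_pmf.integral_le_const integrable_prob_pmf AE_pmfI assms)

text \<open>\<open>E\<close> is the bad event of the first \<open>m\<close> items: on it the
  conditional probability is bounded by 1, elsewhere by \<open>B\<close>. The other \<open>n\<close>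
  items are independent of the prefix, so the prefix may be fixed.\<close>

lemma measure_replicate_pmf_add_le:
  assumes "\<And>ys. ys \<in> set_pmf (replicate_pmf m p) \<Longrightarrow> ys \<notin> E \<Longrightarrow>
      measure_pmf.prob (replicate_pmf n p) {zs. ys @ zs \<in> A} \<le> B"
    and "0 \<le> B"
  shows "measure_pmf.prob (replicate_pmf (m + n) p) A \<le> measure_pmf.prob (replicate_pmf m p) E + B"
proof -
  have "integrable (measure_pmf (replicate_pmf m p)) (\<lambda>ys. indicator E ys + B)"
    by (intro Bochner_Integration.integrable_add integrable_real_indicator)
       (auto simp: less_top[symmetric])
  then have "measure_pmf.prob (replicate_pmf (m + n) p) A
      \<le> (\<integral>ys. indicator E ys + B \<partial>measure_pmf (replicate_pmf m p))"
    unfolding measure_replicate_pmf_add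
    using assms
    by (intro integral_mono_AE integrable_prob_pmf AE_pmfI; (assumption)?)
       (auto simp: indicator_def intro: order_trans[OF measure_pmf.prob_le_1])
  also have "\<dots> = measure_pmf.prob (replicate_pmf m p) E + B"
    by (subst Bochner_Integration.integral_add) (auto simp: less_top[symmetric])
  finally show ?thesis .
qed

section \<open>Chernoff and Bernstein bounds for one counter\<close>

text \<open>Induction over the items replaces the moment generating function of the sum: an item at
  \<open>i\<close> lowers the level \<open>a\<close> by 1, which costs a factor
  \<open>exp l\<close>, and any other item leaves it as it is. For \<open>n = 0\<close> the event is
  empty unless \<open>a \<le> 0\<close>, and then \<open>exp (- l * a)\<close> is at least
  1.\<close>

lemma count_list_chernoff:
  fixes a l :: real
  assumes "0 \<le> l"
  shows "measure_pmf.prob (replicate_pmf n \<mu>) {xs. a \<le> real (count_list xs i)}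
    \<le> exp (- l * a) * (pmf \<mu> i * exp l + (1 - pmf \<mu> i)) ^ n"
proof (induction n arbitrary: a)
  case 0
  then show ?case using assms by (auto simp: indicator_def mult_nonneg_nonpos)
next
  case (Suc n)
  define M where "M = pmf \<mu> i * exp l + (1 - pmf \<mu> i)"
  \<comment> \<open>\<open>g x\<close> is the induction hypothesis after the first item
    \<open>x\<close>: level \<open>a - 1\<close> if \<open>x = i\<close>, level \<open>a\<close>
    otherwise.\<close>
  define g where "g = (\<lambda>x. exp (- l * a) * M ^ n * (1 + (exp l - 1) * indicator {i} x))"
  have int: "integrable (measure_pmf \<mu>) g"
    unfolding g_def
    by (intro integrable_mult_right Bochner_Integration.integrable_add integrable_real_indicator)
       (auto simp: less_top[symmetric])
  have "measure_pmf.prob (replicate_pmf n \<mu>) {xs. x # xs \<in> {xs. a \<le> real (count_list xs i)}} \<le> g x" for x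
  proof (cases "x = i")
    case True
    have "measure_pmf.prob (replicate_pmf n \<mu>) {xs. a - 1 \<le> real (count_list xs i)}
        \<le> exp (- l * (a - 1)) * M ^ n"
      unfolding M_def by (rule Suc.IH)
    then show ?thesis using True
      by (simp add: g_def right_diff_distrib exp_diff exp_minus diff_le_eq add.commute mult_ac divide_simps)
  next
    case False
    then show ?thesis using Suc.IH[of a] by (simp add: g_def M_def)
  qed
  then have "measure_pmf.prob (replicate_pmf (Suc n) \<mu>) {xs. a \<le> real (count_list xs i)}
      \<le> (\<integral>x. g x \<partial>measure_pmf \<mu>)"
    unfolding measure_replicate_pmf_Suc
    by (intro integral_mono integrable_prob_pmf int)
  also have "\<dots> = exp (- l * a) * M ^ n * (1 + (exp l - 1) * pmf \<mu> i)"
    unfolding g_def integral_mult_right_zero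
    by (subst Bochner_Integration.integral_add) (auto simp: less_top[symmetric] measure_pmf_single)
  also have "\<dots> = exp (- l * a) * M ^ Suc n"
    by (simp add: M_def algebra_simps)
  finally show ?case by (simp add: M_def)
qed

text \<open>Bernstein's inequality solved for the deviation: \<open>a = r + 2 / 3 * L\<close> with
  \<open>r\<^sup>2 = 2 * v * L\<close> satisfies \<open>a\<^sup>2 \<ge> 2 * L * (v + a / 3)\<close>,
  which makes the usual exponent at most \<open>- L\<close>.\<close>

lemma count_list_bernstein:
  fixes L :: real and \<mu> :: "'a pmf" and i :: 'a
  assumes "0 < L"
  defines "p \<equiv> pmf \<mu> i"
  shows "measure_pmf.prob (replicate_pmf n \<mu>)
      {xs. real n * p + sqrt (2 * real n * p * (1 - p) * L) + 2 / 3 * L \<le> real (count_list xs i)}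
    \<le> exp (- L)"
proof -
  have p: "0 \<le> p" "p \<le> 1" by (auto simp: p_def pmf_le_1)
  define v where "v = real n * (p * (1 - p))"
  have v: "0 \<le> v" using p by (simp add: v_def)
  define r where "r = sqrt (2 * v * L)"
  have r: "0 \<le> r" "r\<^sup>2 = 2 * v * L" using v assms by (auto simp: r_def)
  define a where "a = r + 2 / 3 * L"
  have a: "0 < a" using r assms by (simp add: a_def)
  have tail: "measure_pmf.prob (replicate_pmf n \<mu>) {xs. real n * p + a \<le> real (count_list xs i)}
      \<le> exp (- l * a + v * l\<^sup>2 / (2 * (1 - l / 3)))" if l: "0 \<le> l" "l < 3" for l
  proof -
    have "measure_pmf.prob (replicate_pmf n \<mu>) {xs. real n * p + a \<le> real (count_list xs i)}
        \<le> exp (- l * (real n * p + a)) * (p * exp l + (1 - p)) ^ n"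
      unfolding p_def by (rule count_list_chernoff[OF l(1)])
    also have "\<dots> \<le> exp (- l * (real n * p + a)) * exp (p * l + p * (1 - p) * l\<^sup>2 / (2 * (1 - l / 3))) ^ n"
      using bernoulli_mgf_le[OF p l] p by (intro mult_left_mono power_mono) auto
    also have "\<dots> = exp (- l * a + v * l\<^sup>2 / (2 * (1 - l / 3)))"
      by (simp add: v_def algebra_simps flip: exp_of_nat_mult exp_add)
    finally show ?thesis .
  qed
  \<comment> \<open>The usual choice \<open>l = a / (v + a / 3)\<close> turns the exponent into
    \<open>- a\<^sup>2 / (2 * (v + a / 3))\<close>. For \<open>v = 0\<close> it would be the
    excluded value 3; there \<open>a = 2 / 3 * L\<close>, and \<open>l = 3 / 2\<close> gives exactly
    \<open>- L\<close>.\<close>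
  obtain l where l: "0 \<le> l" "l < 3" "- l * a + v * l\<^sup>2 / (2 * (1 - l / 3)) \<le> - L"
  proof (cases "v = 0")
    case True
    then show ?thesis using that[of "3 / 2"] r by (simp add: a_def)
  next
    case False
    define l where "l = a / (v + a / 3)"
    have q: "0 < v + a / 3" "0 < v" using False v a by auto
    have l1: "1 - l / 3 = v / (v + a / 3)" using q by (simp add: l_def field_simps)
    have "v * l\<^sup>2 / (2 * (1 - l / 3)) = v * l\<^sup>2 * (v + a / 3) / (2 * v)"
      unfolding l1 by simp
    also have "\<dots> = (l * (v + a / 3)) * l / 2"
      using q by (simp add: power2_eq_square)
    also have "l * (v + a / 3) = a" using q by (simp add: l_def)
    finally have "v * l\<^sup>2 / (2 * (1 - l / 3)) = l * a / 2" by (simp only: mult.commute)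
    then have "- l * a + v * l\<^sup>2 / (2 * (1 - l / 3)) = - (l * a / 2)" by linarith
    also have "l * a / 2 = a\<^sup>2 / (2 * (v + a / 3))"
      using q by (simp add: l_def power2_eq_square)
    also have "- (a\<^sup>2 / (2 * (v + a / 3))) \<le> - L"
    proof -
      have "a\<^sup>2 = r\<^sup>2 + 2 * L * (2 / 3 * r) + (2 / 3 * L)\<^sup>2"
        by (simp add: a_def power2_eq_square algebra_simps)
      also have "\<dots> \<ge> 2 * L * (v + a / 3)"
        using r assms by (simp add: a_def power2_eq_square algebra_simps)
      finally show ?thesis using q by (simp add: pos_le_divide_eq mult_ac)
    qed
    finally show ?thesis using l1 q a by (intro that[of l]) (auto simp: l_def field_simps)
  qed
  have "real n * p + sqrt (2 * real n * p * (1 - p) * L) + 2 / 3 * L = real n * p + a"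
    by (simp add: a_def r_def v_def mult_ac)
  then show ?thesis using order_trans[OF tail[OF l(1,2)]] l(3) by (simp only: exp_le_cancel_iff)
qed

section \<open>Rounds and messages on a fixed sequence of arrivals\<close>

text \<open>The number of rounds that can still start after a CMY or straightforward round.\<close>

definition round_potential :: "nat \<Rightarrow> dt_state \<Rightarrow> real" where
  "round_potential k st =
     (if phase st = Cmy then 1 + log (4 / 3) (real (thr st) / (4 * real k)) else 0)"

text \<open>
  A round is charged \<open>5 * k\<close>: \<open>k\<close> messages announce it, and the other \<open>4 * k\<close> cover either at most
  \<open>k\<close> notifications and \<open>2 * k\<close> messages for the collection, or the at most \<open>4 * k\<close> items of the
  straightforward phase.
\<close>

definition msgs_bounded :: "nat \<Rightarrow> dt_state \<Rightarrow> bool" where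
  "msgs_bounded k st \<longleftrightarrow>
     (case phase st of
        Alarm \<Rightarrow> msgs st \<le> 5 * k * rounds st
      | Static \<Rightarrow> msgs st + 4 * k \<le> 5 * k * rounds st
      | Cmy \<Rightarrow> msgs st + 4 * k \<le> 5 * k * rounds st + notif st
      | Straight \<Rightarrow> thr st \<le> 4 * k \<and> msgs st + 4 * k \<le> 5 * k * rounds st + (\<Sum>i=1..k. cnt st i))"

text \<open>The logarithm counts the factors \<open>4 / 3\<close> between
  \<open>beta * k * ln (k / \<delta>)\<close>, the largest threshold handed to CMY, and
  \<open>4 * k\<close>, below which the straightforward phase begins. The 2 pays for the first CMY
  round and the straightforward one. The logarithm may be negative for small
  \<open>ln (k / \<delta>)\<close>, hence the \<open>max\<close>.\<close>

definition nonstatic_rounds :: "nat \<Rightarrow> real \<Rightarrow> real" where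
  "nonstatic_rounds k \<delta> = 2 + max 0 (log (4 / 3) (beta * ln (real k / \<delta>) / 4))"

context
  fixes k :: nat and \<delta> :: real and \<mu> :: "nat pmf"
  assumes k: "1 \<le> k" and \<delta>: "0 < \<delta>" "\<delta> < 1" and \<mu>: "set_pmf \<mu> \<subseteq> {1..k}"
begin

section \<open>The message budget of a round\<close>

lemma msgs_bounded_begin_cmy:
  assumes "msgs st \<le> 5 * k * rounds st"
  shows "msgs_bounded k (begin_cmy k st)"
  using assms by (auto simp: msgs_bounded_def begin_cmy_def begin_round_def algebra_simps)

lemma msgs_bounded_begin_main:
  assumes "msgs st \<le> 5 * k * rounds st"
  shows "msgs_bounded k (begin_main k \<delta> st)"
  using assms msgs_bounded_begin_cmy[OF assms]
  by (auto simp: begin_main_def) (auto simp: msgs_bounded_def begin_round_def algebra_simps)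

lemma msgs_bounded_end_round:
  assumes "msgs st + 2 * k \<le> 5 * k * rounds st"
    and "\<And>st'. msgs st' \<le> 5 * k * rounds st' \<Longrightarrow> msgs_bounded k (start st')"
  shows "msgs_bounded k (end_round k start st)"
  using assms by (auto simp: end_round_def Let_def) (simp add: msgs_bounded_def)

lemma msgs_bounded_step:
  assumes b: "msgs_bounded k st" and i: "i \<in> {1..k}"
  shows "msgs_bounded k (dt_step k \<delta> \<mu> st i)"
proof (cases "phase st")
  case Straight
  then show ?thesis
    using b sum_upd[OF i, of "cnt st" "Suc (cnt st i)"]
    by (auto simp: dt_step_def msgs_bounded_def Let_def)
next
  case Cmy
  then have m: "msgs st + 4 * k \<le> 5 * k * rounds st + notif st"
    using b by (simp add: msgs_bounded_def)
  have "msgs_bounded k (end_round k (begin_cmy k) (st\<lparr>cnt := c, reported := r, notif := n, msgs := msgs st + 1\<rparr>))"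
    if "notif st + 1 = k" for c r n
    using m that by (intro msgs_bounded_end_round msgs_bounded_begin_cmy) auto
  then show ?thesis
    using Cmy m unfolding dt_step_def Let_def
    by (auto simp: msgs_bounded_def[of _ "_\<lparr>cnt := _\<rparr>"] msgs_bounded_def[of _ "_\<lparr>msgs := _\<rparr>"])
next
  case Static
  then have m: "msgs st + 4 * k \<le> 5 * k * rounds st"
    using b by (simp add: msgs_bounded_def)
  have "msgs_bounded k (end_round k (begin_main k \<delta>) (st\<lparr>cnt := c, msgs := msgs st + 1\<rparr>))" for c
    using m k by (intro msgs_bounded_end_round msgs_bounded_begin_main) auto
  then show ?thesis
    using Static m by (auto simp: dt_step_def Let_def msgs_bounded_def[of _ "_\<lparr>cnt := _\<rparr>"])
next
  case Alarm
  then show ?thesis using b by (simp add: dt_step_def)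
qed

lemma dt_inv_foldl:
  assumes "dt_inv k \<delta> \<mu> N m st" "m + length xs \<le> N" "set xs \<subseteq> {1..k}"
  shows "dt_inv k \<delta> \<mu> N (m + length xs) (foldl (dt_step k \<delta> \<mu>) st xs)"
  using assms
proof (induction xs arbitrary: m st)
  case (Cons x xs)
  have "dt_inv k \<delta> \<mu> N (Suc m) (dt_step k \<delta> \<mu> st x)"
    using Cons.prems by (intro dt_inv_step[OF k \<delta> \<mu>]) auto
  from Cons.IH[OF this] Cons.prems show ?case by simp
qed simp

lemma msgs_stc_slk_kwn_dst_le:
  assumes "1 \<le> N" "set xs \<subseteq> {1..k}" "length xs = N"
  shows "msgs (stc_slk_kwn_dst k \<delta> \<mu> N xs) \<le> 5 * k * rounds (stc_slk_kwn_dst k \<delta> \<mu> N xs)"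
proof -
  have "msgs_bounded k (stc_slk_kwn_dst k \<delta> \<mu> N xs)"
    using assms(2)
    by (induction xs rule: rev_induct)
       (auto simp: stc_slk_kwn_dst_def intro!: msgs_bounded_step msgs_bounded_begin_main)
  moreover have "phase (stc_slk_kwn_dst k \<delta> \<mu> N xs) = Alarm"
    using alarm_iff_last_item[OF k \<delta> \<mu>] assms by simp
  ultimately show ?thesis by (simp add: msgs_bounded_def)
qed

section \<open>The number of CMY rounds\<close>

lemma round_potential_begin_cmy:
  assumes "0 < thr st"
  shows "real (rounds (begin_cmy k st)) + round_potential k (begin_cmy k st)
      \<le> real (rounds st) + 2 + max 0 (log (4 / 3) (real (thr st) / (4 * real k)))"
  by (auto simp: begin_cmy_def begin_round_def round_potential_def)

text \<open>At most three quarters of the threshold remain, so the logarithm to base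
  \<open>4 / 3\<close> drops by at least 1, which pays for another CMY round. If the straightforward
  phase follows instead, the summand 1 of the potential pays for it.\<close>

lemma round_potential_end_cmy:
  assumes "phase st = Cmy" "4 * k \<le> thr st" "thr st \<le> 4 * (\<Sum>i=1..k. cnt st i)"
  shows "phase (end_round k (begin_cmy k) st) \<noteq> Static"
    and "real (rounds (end_round k (begin_cmy k) st)) + round_potential k (end_round k (begin_cmy k) st)
      \<le> real (rounds st) + round_potential k st"
proof -
  define M' where "M' = thr st - (\<Sum>i=1..k. cnt st i)"
  have log0: "0 \<le> log (4 / 3) (real (thr st) / (4 * real k))"
    using assms(2) k by (subst zero_le_log_cancel_iff) auto
  have step: "1 + log (4 / 3) (real M' / (4 * real k)) \<le> log (4 / 3) (real (thr st) / (4 * real k))"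
    if "4 * k \<le> M'"
  proof -
    have "real (4 * M') \<le> real (3 * thr st)"
      using assms(3) by (subst of_nat_le_iff) (auto simp: M'_def)
    have "1 + log (4 / 3) (real M' / (4 * real k)) = log (4 / 3) (4 / 3 * (real M' / (4 * real k)))"
      using that k by (subst log_mult) auto
    also have "\<dots> \<le> log (4 / 3) (real (thr st) / (4 * real k))"
      using that k \<open>real (4 * M') \<le> real (3 * thr st)\<close>
      by (subst log_le_cancel_iff) (auto simp: field_simps)
    finally show ?thesis .
  qed
  define st' where "st' = st\<lparr>thr := M', msgs := msgs st + 2 * k\<rparr>"
  have "end_round k (begin_cmy k) st = (if M' = 0 then st'\<lparr>phase := Alarm\<rparr> else begin_cmy k st')"
    by (simp add: end_round_def Let_def M'_def st'_def)
  then show "phase (end_round k (begin_cmy k) st) \<noteq> Static"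
    and "real (rounds (end_round k (begin_cmy k) st)) + round_potential k (end_round k (begin_cmy k) st)
      \<le> real (rounds st) + round_potential k st"
    using assms(1) log0 step
    by (auto simp: st'_def begin_cmy_def begin_round_def round_potential_def)
qed

lemma round_potential_step:
  assumes inv: "dt_inv k \<delta> \<mu> N m st" and i: "i \<in> {1..k}" and ph: "phase st \<noteq> Static"
  shows "phase (dt_step k \<delta> \<mu> st i) \<noteq> Static \<and>
    real (rounds (dt_step k \<delta> \<mu> st i)) + round_potential k (dt_step k \<delta> \<mu> st i)
      \<le> real (rounds st) + round_potential k st"
proof (cases "phase st")
  case Cmy
  define s where "s = cmy_slack k (thr st)"
  define c where "c = (cnt st)(i := Suc (cnt st i))"
  define r where "r = (reported st)(i := c i)"
  have I: "4 * k \<le> thr st" "(\<Sum>i=1..k. reported st i) = notif st * s"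
      "\<And>i. i \<in> {1..k} \<Longrightarrow> reported st i \<le> cnt st i"
    using inv Cmy by (auto simp: dt_inv_def s_def)
  show ?thesis
  proof (cases "s \<le> c i - reported st i \<and> notif st + 1 = k")
    case True
    have "1 \<le> s" using I(1) k by (simp add: s_def cmy_slack_def Suc_le_eq div_greater_zero_iff)
    have "(\<Sum>j=1..k. r j) + reported st i = notif st * s + c i"
      using sum_upd[OF i, of "reported st" "c i"] I(2) by (simp add: r_def)
    then have "notif st * s + s \<le> (\<Sum>j=1..k. r j)"
      using True \<open>1 \<le> s\<close> by linarith
    also have "\<dots> \<le> (\<Sum>j=1..k. c j)"
      using I(3) by (intro sum_mono) (auto simp: r_def c_def)
    finally have "k * s \<le> (\<Sum>j=1..k. c j)"
      by (subst conjunct2[OF True, symmetric]) simp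
    \<comment> \<open>The \<open>k\<close> notifications account for at least \<open>k * s\<close>
      items. Rounding the slack down loses less than 1, and \<open>1 \<le> s\<close> gives
      \<open>Suc s \<le> 2 * s\<close>; so these items are at least a quarter of the
      threshold.\<close>
    moreover have "thr st < 2 * k * Suc s"
      using dividend_less_times_div[of "2 * k" "thr st"] k by (simp add: s_def cmy_slack_def)
    moreover have "2 * k * Suc s \<le> 4 * (k * s)"
      using \<open>1 \<le> s\<close> by simp
    ultimately have "thr st \<le> 4 * (\<Sum>j=1..k. c j)" by linarith
    moreover define st2 where "st2 = st\<lparr>cnt := c, reported := r, notif := notif st + 1, msgs := msgs st + 1\<rparr>"
    moreover have "dt_step k \<delta> \<mu> st i = end_round k (begin_cmy k) st2"
      using True Cmy by (simp add: dt_step_def Let_def c_def r_def s_def st2_def)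
    moreover have "round_potential k st2 = round_potential k st"
      by (simp add: round_potential_def st2_def)
    ultimately show ?thesis
      using Cmy I(1) round_potential_end_cmy[of st2] by simp
  next
    case False
    then show ?thesis using Cmy
      by (auto simp: dt_step_def Let_def round_potential_def c_def s_def)
  qed
qed (use ph in \<open>auto simp: dt_step_def Let_def round_potential_def\<close>)

lemma rounds_foldl_le:
  assumes "dt_inv k \<delta> \<mu> N m st" "m + length xs \<le> N" "set xs \<subseteq> {1..k}" "phase st \<noteq> Static"
  shows "real (rounds (foldl (dt_step k \<delta> \<mu>) st xs)) \<le> real (rounds st) + round_potential k st"
  using assms
proof (induction xs arbitrary: m st)
  case Nil
  then have "0 \<le> log (4 / 3) (real (thr st) / (4 * real k))" if "phase st = Cmy"
    using k that by (subst zero_le_log_cancel_iff) (auto simp: dt_inv_def)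
  then have "0 \<le> round_potential k st"
    by (auto simp: round_potential_def)
  then show ?case by simp
next
  case (Cons x xs)
  have inv: "dt_inv k \<delta> \<mu> N (Suc m) (dt_step k \<delta> \<mu> st x)"
    using Cons.prems by (intro dt_inv_step[OF k \<delta> \<mu>]) auto
  have step: "phase (dt_step k \<delta> \<mu> st x) \<noteq> Static \<and>
    real (rounds (dt_step k \<delta> \<mu> st x)) + round_potential k (dt_step k \<delta> \<mu> st x)
      \<le> real (rounds st) + round_potential k st"
    using Cons.prems by (intro round_potential_step) auto
  show ?case using Cons.IH[OF inv] Cons.prems step by simp
qed

section \<open>Static rounds before their first notification\<close>

text \<open>Counters only grow, so if no slack is reached at the end of \<open>ys\<close>, none was
  reached on the way, and every step merely counts.\<close>

lemma static_foldl:
  assumes "phase st = Static" "set ys \<subseteq> {1..k}"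
    and "\<And>i. i \<in> {1..k} \<Longrightarrow> real (cnt st i + count_list ys i) < static_slack k \<delta> \<mu> (thr st) i"
  shows "foldl (dt_step k \<delta> \<mu>) st ys = st\<lparr>cnt := (\<lambda>i. cnt st i + count_list ys i)\<rparr>"
  using assms
proof (induction ys arbitrary: st)
  case (Cons y ys)
  define st1 where "st1 = st\<lparr>cnt := (cnt st)(y := cnt st y + 1)\<rparr>"
  have "real (cnt st1 y) < static_slack k \<delta> \<mu> (thr st) y"
    using Cons.prems(3)[of y] Cons.prems(2) by (simp add: st1_def)
  then have "dt_step k \<delta> \<mu> st y = st1"
    using Cons.prems(1) by (simp add: dt_step_def st1_def)
  moreover have "foldl (dt_step k \<delta> \<mu>) st1 ys = st1\<lparr>cnt := (\<lambda>i. cnt st1 i + count_list ys i)\<rparr>"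
    using Cons.prems
  proof (intro Cons.IH)
    fix i assume "i \<in> {1..k}"
    from Cons.prems(3)[OF this]
    show "real (cnt st1 i + count_list ys i) < static_slack k \<delta> \<mu> (thr st1) i"
      by (auto simp: st1_def split: if_splits)
  qed (auto simp: st1_def)
  ultimately show ?case by (auto simp: st1_def fun_eq_iff intro!: arg_cong[where f = "\<lambda>c. st\<lparr>cnt := c\<rparr>"])
qed simp

section \<open>Probability of too many static rounds\<close>

text \<open>
  The current round ends at a random time. Conditioning on one item after the other, every way of
  ending it leaves a threshold of at most \<open>M\<close>, to which the assumed bound applies.
\<close>

lemma prob_static_round_tail:
  assumes follow: "\<And>st'. 0 < thr st' \<Longrightarrow> thr st' \<le> M \<Longrightarrow> rounds st' = r \<Longrightarrow>
      measure_pmf.prob (replicate_pmf (thr st') \<mu>)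
        {xs. b < real (rounds (foldl (dt_step k \<delta> \<mu>) (begin_main k \<delta> st') xs))} \<le> B"
    and B: "0 \<le> B" and b: "real r \<le> b"
    and "dt_inv k \<delta> \<mu> N m st" "phase st = Static" "rounds st = r" "N - m = n" "n \<le> M + 1"
  shows "measure_pmf.prob (replicate_pmf n \<mu>)
      {xs. b < real (rounds (foldl (dt_step k \<delta> \<mu>) st xs))} \<le> B"
  using assms(4-)
proof (induction n arbitrary: m st)
  case 0
  then show ?case by (auto simp: dt_inv_def)
next
  case (Suc n)
  show ?case
  proof (rule measure_replicate_pmf_Suc_le)
    fix x assume "x \<in> set_pmf \<mu>"
    then have x: "x \<in> {1..k}" using \<mu> by auto
    define c where "c = (cnt st)(x := Suc (cnt st x))"
    have sc: "(\<Sum>j=1..k. c j) = Suc (\<Sum>j=1..k. cnt st j)"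
      using sum_upd[OF x, of "cnt st" "Suc (cnt st x)"] by (simp add: c_def)
    have "m + thr st = N + (\<Sum>j=1..k. cnt st j)"
      using Suc.prems by (auto simp: dt_inv_def)
    \<comment> \<open>If this item ends the round, the new threshold is exactly the number
      \<open>n\<close> of items to come, so \<open>follow\<close> speaks of the same distribution.
      From \<open>Suc n \<le> M + 1\<close> it is at most \<open>M\<close>.\<close>
    then have thr': "thr st - (\<Sum>j=1..k. c j) = n"
      using sc Suc.prems(4) by linarith
    have inv: "dt_inv k \<delta> \<mu> N (Suc m) (dt_step k \<delta> \<mu> st x)"
      using Suc.prems x by (intro dt_inv_step[OF k \<delta> \<mu>]) auto
    have "measure_pmf.prob (replicate_pmf n \<mu>)
        {xs. b < real (rounds (foldl (dt_step k \<delta> \<mu>) (dt_step k \<delta> \<mu> st x) xs))} \<le> B"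
    proof (cases "static_slack k \<delta> \<mu> (thr st) x \<le> real (c x)")
      case False
      then have step: "dt_step k \<delta> \<mu> st x = st\<lparr>cnt := c\<rparr>"
        using Suc.prems(2) by (simp add: dt_step_def c_def)
      show ?thesis
        using Suc.prems inv unfolding step by (intro Suc.IH[of "Suc m"]) auto
    next
      case True
      define st' where "st' = st\<lparr>cnt := c, thr := n, msgs := msgs st + 1 + 2 * k\<rparr>"
      have step: "dt_step k \<delta> \<mu> st x =
          (if n = 0 then st'\<lparr>phase := Alarm\<rparr> else begin_main k \<delta> st')"
        using True Suc.prems(2) thr'
        by (simp add: dt_step_def end_round_def Let_def c_def st'_def)
      show ?thesis
      proof (cases "n = 0")
        case True
        then show ?thesis
          using step Suc.prems(3) B b by (simp add: st'_def indicator_def)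
      next
        case False
        then show ?thesis
          using step Suc.prems(3,5) follow[of st'] by (simp add: st'_def)
      qed
    qed
    then show "measure_pmf.prob (replicate_pmf n \<mu>)
        {xs. x # xs \<in> {xs. b < real (rounds (foldl (dt_step k \<delta> \<mu>) st xs))}} \<le> B"
      by simp
  qed
qed

text \<open>Union bound over \<open>k\<close> players, each failing with probability at most
  \<open>exp (- L) = \<delta> / k\<close>. The target need not be an integer; the slack formula
  increases with the target, so \<open>n\<close> below it suffices.\<close>

lemma prob_static_slack_exceeded_le:
  assumes "real n \<le> static_target k \<delta> M"
  shows "measure_pmf.prob (replicate_pmf n \<mu>)
      {ys. \<exists>i\<in>{1..k}. static_slack k \<delta> \<mu> M i \<le> real (count_list ys i)} \<le> \<delta>"
proof -
  define L where "L = ln (real k / \<delta>)"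
  have L: "0 < L" using L_pos[OF k \<delta> \<mu>] by (simp add: L_def)
  have "measure_pmf.prob (replicate_pmf n \<mu>)
      {ys. \<exists>i\<in>{1..k}. static_slack k \<delta> \<mu> M i \<le> real (count_list ys i)}
    = measure_pmf.prob (replicate_pmf n \<mu>)
      (\<Union>i\<in>{1..k}. {ys. static_slack k \<delta> \<mu> M i \<le> real (count_list ys i)})"
    by (intro arg_cong[where f = "measure_pmf.prob _"]) auto
  also have "\<dots> \<le> (\<Sum>i=1..k. measure_pmf.prob (replicate_pmf n \<mu>)
      {ys. static_slack k \<delta> \<mu> M i \<le> real (count_list ys i)})"
    by (intro measure_pmf.finite_measure_subadditive_finite) auto
  also have "\<dots> \<le> (\<Sum>i=1..k. exp (- L))"
  proof (intro sum_mono)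
    fix i
    define p where "p = pmf \<mu> i"
    have p: "0 \<le> p" "p \<le> 1" by (auto simp: p_def pmf_le_1)
    have "real n * p + sqrt (2 * real n * p * (1 - p) * L) + 2 / 3 * L \<le> static_slack k \<delta> \<mu> M i"
      using assms p L unfolding static_slack_def Let_def L_def[symmetric] p_def[symmetric]
      by (subst mult.commute[of p])
         (intro add_mono real_sqrt_le_mono mult_right_mono order_refl; simp)
    then have "measure_pmf.prob (replicate_pmf n \<mu>) {ys. static_slack k \<delta> \<mu> M i \<le> real (count_list ys i)}
        \<le> measure_pmf.prob (replicate_pmf n \<mu>)
          {ys. real n * p + sqrt (2 * real n * p * (1 - p) * L) + 2 / 3 * L \<le> real (count_list ys i)}"
      by (intro measure_pmf.finite_measure_mono) auto
    also have "\<dots> \<le> exp (- L)"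
      unfolding p_def by (rule count_list_bernstein[OF L])
    finally show "measure_pmf.prob (replicate_pmf n \<mu>)
        {ys. static_slack k \<delta> \<mu> M i \<le> real (count_list ys i)} \<le> exp (- L)" .
  qed
  also have "\<dots> = \<delta>"
    using k \<delta> by (simp add: L_def exp_minus)
  finally show ?thesis .
qed

lemma rounds_nonstatic_le:
  assumes "0 < thr st" "phase (begin_main k \<delta> st) \<noteq> Static" "set xs \<subseteq> {1..k}" "length xs = thr st"
  shows "real (rounds (foldl (dt_step k \<delta> \<mu>) (begin_main k \<delta> st) xs))
      \<le> real (rounds st) + nonstatic_rounds k \<delta>"
proof -
  have "real (rounds (foldl (dt_step k \<delta> \<mu>) (begin_main k \<delta> st) xs))
      \<le> real (rounds (begin_main k \<delta> st)) + round_potential k (begin_main k \<delta> st)"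
    using assms by (intro rounds_foldl_le[where m = 0 and N = "thr st"] dt_inv_begin_main[OF k \<delta> \<mu>]) auto
  also have "\<dots> \<le> real (rounds st) + nonstatic_rounds k \<delta>"
  proof (cases "thr st \<le> 4 * k")
    case True
    then show ?thesis
      by (simp add: begin_main_def begin_round_def round_potential_def nonstatic_rounds_def)
  next
    case False
    then have thr: "real (thr st) \<le> beta * real k * ln (real k / \<delta>)"
        and main: "begin_main k \<delta> st = begin_cmy k st"
      using assms(2) by (auto simp: begin_main_def begin_round_def split: if_splits)
    have "log (4 / 3) (real (thr st) / (4 * real k)) \<le> log (4 / 3) (beta * ln (real k / \<delta>) / 4)"
      using assms(1) k thr by (intro log_mono) (auto simp: field_simps)
    then show ?thesis
      using round_potential_begin_cmy[OF assms(1)] by (simp add: main nonstatic_rounds_def)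
  qed
  finally show ?thesis .
qed

text \<open>\<open>j\<close> bounds the static rounds, and each adds a failure probability
  \<open>\<delta>\<close>. The square root taken by a successful round halves the exponent
  \<open>2 ^ j\<close>. For \<open>j = 0\<close> the bound on the threshold is
  \<open>beta * k * ln (k / \<delta>)\<close>, at which no static round starts.\<close>

lemma prob_rounds_le:
  assumes "0 < thr st"
    and "real (thr st) \<le> (sqrt 2 + 2 / 3)\<^sup>2 * (real k * ln (real k / \<delta>)) * 2 ^ (2 ^ j)"
  shows "measure_pmf.prob (replicate_pmf (thr st) \<mu>)
      {xs. real (rounds st) + real j + nonstatic_rounds k \<delta>
         < real (rounds (foldl (dt_step k \<delta> \<mu>) (begin_main k \<delta> st) xs))} \<le> real j * \<delta>"
  using assms
proof (induction j arbitrary: st)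
  case (0 st)
  then have "phase (begin_main k \<delta> st) \<noteq> Static"
    by (auto simp: begin_main_def begin_cmy_def begin_round_def beta_def mult_ac)
  from rounds_nonstatic_le[OF 0(1) this]
  have "measure_pmf.prob (replicate_pmf (thr st) \<mu>)
      {xs. real (rounds st) + real 0 + nonstatic_rounds k \<delta>
         < real (rounds (foldl (dt_step k \<delta> \<mu>) (begin_main k \<delta> st) xs))} = 0"
    using \<mu> by (fastforce simp: measure_pmf_zero_iff set_replicate_pmf lists_eq_set)
  then show ?case by simp
next
  case (Suc j st)
  define b where "b = real (rounds st) + real (Suc j) + nonstatic_rounds k \<delta>"
  define st0 where "st0 = begin_main k \<delta> st"
  show ?case
  proof (cases "phase st0 = Static")
    case False
    from rounds_nonstatic_le[OF Suc.prems(1) this[unfolded st0_def]]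
    have "measure_pmf.prob (replicate_pmf (thr st) \<mu>)
        {xs. real (rounds st) + real (Suc j) + nonstatic_rounds k \<delta>
           < real (rounds (foldl (dt_step k \<delta> \<mu>) (begin_main k \<delta> st) xs))} = 0"
      using \<mu> by (fastforce simp: measure_pmf_zero_iff set_replicate_pmf lists_eq_set)
    then show ?thesis using \<delta> by simp
  next
    case True
    then have M: "real (thr st) > beta * real k * ln (real k / \<delta>)" and st0: "st0 = begin_round k Static st"
      by (auto simp: st0_def begin_main_def begin_cmy_def begin_round_def split: if_splits)
    define c where "c = sqrt 2 + (2 / 3 :: real)"
    define K where "K = real k * ln (real k / \<delta>)"
    have K: "0 < K" using k L_pos[OF k \<delta> \<mu>] by (simp add: K_def)
    have c: "0 < c" unfolding c_def by (intro add_pos_pos) auto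
    define t where "t = static_target k \<delta> (thr st)"
    have t: "0 < t" using static_target_pos(1)[OF k \<delta> \<mu> M] by (simp add: t_def)
    have t_eq: "t = real (thr st) - c * sqrt (K * real (thr st))"
      by (simp add: t_def static_target_def c_def K_def mult_ac)
    define n where "n = nat \<lfloor>t\<rfloor>"
    have n: "real n \<le> t" "t < real n + 1" using t unfolding n_def by linarith+
    have "t \<le> real (thr st)" using c K by (simp add: t_eq)
    then have nM: "n \<le> thr st" using n by linarith
    define E where "E = {ys. \<exists>i\<in>{1..k}. static_slack k \<delta> \<mu> (thr st) i \<le> real (count_list ys i)}"
    have "measure_pmf.prob (replicate_pmf (n + (thr st - n)) \<mu>)
        {xs. b < real (rounds (foldl (dt_step k \<delta> \<mu>) st0 xs))}
      \<le> measure_pmf.prob (replicate_pmf n \<mu>) E + real j * \<delta>"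
    proof (rule measure_replicate_pmf_add_le)
      fix ys assume "ys \<in> set_pmf (replicate_pmf n \<mu>)" and E: "ys \<notin> E"
      then have ys: "set ys \<subseteq> {1..k}" "length ys = n"
        using \<mu> by (auto simp: set_replicate_pmf lists_eq_set)
      define sy where "sy = foldl (dt_step k \<delta> \<mu>) st0 ys"
      have "sy = st0\<lparr>cnt := (\<lambda>i. cnt st0 i + count_list ys i)\<rparr>"
        unfolding sy_def using E ys True
        by (intro static_foldl) (auto simp: st0 begin_round_def E_def not_le)
      then have sy: "phase sy = Static" "rounds sy = rounds st + 1"
        by (simp_all add: st0 begin_round_def)
      have "dt_inv k \<delta> \<mu> (thr st) 0 st0"
        unfolding st0_def using Suc.prems(1) by (intro dt_inv_begin_main[OF k \<delta> \<mu>]) auto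
      from dt_inv_foldl[OF this] ys nM have inv: "dt_inv k \<delta> \<mu> (thr st) n sy"
        by (auto simp: sy_def)
      have "measure_pmf.prob (replicate_pmf (thr st - n) \<mu>)
          {zs. b < real (rounds (foldl (dt_step k \<delta> \<mu>) sy zs))} \<le> real j * \<delta>"
      proof (rule prob_static_round_tail[OF _ _ _ inv sy refl])
        fix st' :: dt_state
        assume st': "0 < thr st'" "thr st' \<le> thr st - n - 1" "rounds st' = rounds st + 1"
        define q :: real where "q = 2 ^ 2 ^ j"
        \<comment> \<open>The item that ends the round comes after the first \<open>n\<close>; this
          one further item makes up for rounding \<open>t\<close> down to \<open>n\<close>.\<close>
        have "real (thr st') \<le> real (thr st) - real n - 1"
          using st' by linarith
        also have "\<dots> \<le> c * sqrt (K * real (thr st))"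
          using n t_eq by linarith
        also have "sqrt (K * real (thr st)) \<le> c * K * q"
        proof (rule real_le_lsqrt)
          have "(2::real) ^ 2 ^ Suc j = q\<^sup>2"
            by (simp only: q_def power_Suc flip: power_mult) (simp only: mult.commute)
          then have "K * real (thr st) \<le> K * (c\<^sup>2 * K * q\<^sup>2)"
            using Suc.prems(2) K unfolding c_def[symmetric] K_def[symmetric]
            by (intro mult_left_mono) (simp_all only: less_imp_le)
          then show "K * real (thr st) \<le> (c * K * q)\<^sup>2"
            by (simp add: power2_eq_square mult_ac)
        qed (use c K in \<open>auto simp: q_def\<close>)
        finally have "real (thr st') \<le> c\<^sup>2 * K * q"
          using c by (simp add: power2_eq_square mult_ac)
        then show "measure_pmf.prob (replicate_pmf (thr st') \<mu>)
            {xs. b < real (rounds (foldl (dt_step k \<delta> \<mu>) (begin_main k \<delta> st') xs))} \<le> real j * \<delta>"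
          using Suc.IH[OF st'(1)] st'(3)
          by (simp add: b_def c_def K_def q_def add_ac)
      qed (use \<delta> in \<open>auto simp: b_def nonstatic_rounds_def\<close>)
      then show "measure_pmf.prob (replicate_pmf (thr st - n) \<mu>)
          {zs. ys @ zs \<in> {xs. b < real (rounds (foldl (dt_step k \<delta> \<mu>) st0 xs))}} \<le> real j * \<delta>"
        by (simp add: sy_def)
    qed (use \<delta> in auto)
    also have "measure_pmf.prob (replicate_pmf n \<mu>) E \<le> \<delta>"
      unfolding E_def using n by (intro prob_static_slack_exceeded_le) (auto simp: t_def)
    finally show ?thesis
      using nM by (simp add: b_def st0_def algebra_simps)
  qed
qed

end

section \<open>Iterated logarithms\<close>

lemma loglog_ge_1: "1 \<le> loglog x"
proof -
  have "ln (ln (exp (exp (1::real)))) \<le> loglog x"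
    unfolding loglog_def by (intro ln_mono) auto
  then show ?thesis by simp
qed

lemma loglog_mono: "0 < x \<Longrightarrow> x \<le> y \<Longrightarrow> loglog x \<le> loglog y"
proof -
  have "1 < exp (exp (1::real))" by simp
  then have "1 < max x (exp (exp 1))" for x :: real by linarith
  then show "0 < x \<Longrightarrow> x \<le> y \<Longrightarrow> loglog x \<le> loglog y"
    unfolding loglog_def by (intro ln_mono ln_gt_zero) (auto simp: less_max_iff_disj)
qed

lemma ln_le_exp_loglog:
  assumes "0 < x"
  shows "ln x \<le> exp (loglog x)"
proof -
  have "1 < exp (exp (1::real))" by simp
  then have "1 < max x (exp (exp 1))" by linarith
  then have "exp (loglog x) = ln (max x (exp (exp 1)))"
    unfolding loglog_def by (intro exp_ln ln_gt_zero)
  moreover have "ln x \<le> ln (max x (exp (exp 1)))"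
    using assms by (intro ln_mono) auto
  ultimately show ?thesis by simp
qed

text \<open>After taking logarithms, \<open>exp w \<le> 2 ^ j * ln 2\<close> is needed. From
  \<open>ln 2 \<ge> 2 / 3\<close> and \<open>j \<ge> 3 * w\<close> one gets
  \<open>2 ^ j \<ge> exp (2 * w)\<close>, and the spare factor \<open>exp w \<ge> 2\<close>
  outweighs the final \<open>ln 2\<close>.\<close>

lemma le_double_power_loglog:
  assumes x: "0 < x" and j: "3 * loglog x \<le> real j"
  shows "x \<le> 2 ^ (2 ^ j)"
proof -
  define w where "w = loglog x"
  have w: "1 \<le> w" by (simp add: w_def loglog_ge_1)
  have ln2: "2 / 3 \<le> ln (2::real)" by (rule ln2_ge_two_thirds)
  have "2 \<le> exp w" using w exp_ge_add_one_self[of w] by linarith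
  have "ln x \<le> exp w" using ln_le_exp_loglog[OF x] by (simp add: w_def)
  also have "\<dots> \<le> exp w * (exp w * (2 / 3))"
    using \<open>2 \<le> exp w\<close> by simp
  also have "\<dots> = exp (2 * w) * (2 / 3)"
    by (simp flip: exp_add)
  also have "\<dots> \<le> exp (real j * ln 2) * ln 2"
  proof (intro mult_mono)
    have "2 * w = (3 * w) * (2 / 3)" by simp
    also have "\<dots> \<le> real j * ln 2"
      using j w ln2 by (intro mult_mono) (auto simp: w_def)
    finally show "exp (2 * w) \<le> exp (real j * ln 2)" by simp
  qed (use ln2 in auto)
  also have "\<dots> = real (2 ^ j) * ln 2"
    by (simp add: exp_of_nat_mult)
  finally have "exp (ln x) \<le> exp (real (2 ^ j) * ln 2)" by simp
  also have "\<dots> = 2 ^ (2 ^ j)" unfolding exp_of_nat_mult by simp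
  finally show ?thesis using x by simp
qed

text \<open>\<open>beta / 4 \<le> exp 2\<close> gives
  \<open>ln (beta * L / 4) \<le> 2 + v \<le> 3 * v\<close>. Dividing by
  \<open>ln (4 / 3) \<ge> 1 / 4\<close> yields \<open>12 * v\<close>, and the constant 2 is at most
  \<open>2 * v\<close>.\<close>

lemma nonstatic_rounds_le:
  assumes L: "0 < ln (real k / \<delta>)" and pos: "0 < real k / \<delta>"
  shows "nonstatic_rounds k \<delta> \<le> 14 * loglog (real k / \<delta>)"
proof -
  define L where "L = ln (real k / \<delta>)"
  define v where "v = loglog (real k / \<delta>)"
  have v: "1 \<le> v" by (simp add: v_def loglog_ge_1)
  have "L \<le> exp v" using ln_le_exp_loglog[OF pos] by (simp add: L_def v_def)
  have "beta / 4 \<le> exp 2"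
  proof -
    have "sqrt 2 \<le> (3 / 2 :: real)" by (rule real_le_lsqrt) (auto simp: power2_eq_square)
    then have "(sqrt 2 + 2 / 3)\<^sup>2 \<le> (13 / 6 :: real)\<^sup>2" by (intro power_mono) auto
    then show ?thesis
      using exp_ge_add_one_self[of "2::real"] unfolding beta_def by (simp add: power2_eq_square)
  qed
  have "0 < sqrt 2 + (2 / 3 :: real)" by (intro add_pos_pos) auto
  then have "0 < beta" by (simp add: beta_def)
  have "beta * L / 4 \<le> exp 2 * exp v"
    using mult_mono[OF \<open>beta / 4 \<le> exp 2\<close> \<open>L \<le> exp v\<close>] L by (simp add: L_def)
  then have "beta * L / 4 \<le> exp (2 + v)" by (simp add: exp_add)
  then have "ln (beta * L / 4) \<le> ln (exp (2 + v))"
    using L \<open>0 < beta\<close> by (intro ln_mono) (simp_all add: L_def)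
  then have "ln (beta * L / 4) \<le> 3 * v" using v by simp
  moreover have "1 / 4 \<le> ln (4 / 3 :: real)"
    using ln_le_minus_one[of "3 / 4 :: real"] by (simp add: ln_div)
  ultimately have "log (4 / 3) (beta * L / 4) \<le> 3 * v / (1 / 4)"
    unfolding log_def using v by (intro frac_le) auto
  then show ?thesis using v by (simp add: nonstatic_rounds_def L_def v_def)
qed

theorem theorem4p1:
  "\<exists>C\<^sub>p C\<^sub>r C\<^sub>c :: real. C\<^sub>p > 0 \<and> C\<^sub>r > 0 \<and> C\<^sub>c > 0 \<and>
     (\<forall>(k::nat) (N::nat) (\<mu>::nat pmf) (\<delta>::real).
        1 \<le> k \<and> 1 \<le> N \<and> set_pmf \<mu> \<subseteq> {1..k} \<and> 0 < \<delta> \<and> \<delta> < 1 \<longrightarrow>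
        measure_pmf.prob (replicate_pmf N \<mu>)
          {xs. real (rounds (stc_slk_kwn_dst k \<delta> \<mu> N xs))
                 \<le> C\<^sub>r * (loglog (real N / (real k * ln (real k / \<delta>))) + loglog (real k / \<delta>)) \<and>
               real (msgs (stc_slk_kwn_dst k \<delta> \<mu> N xs))
                 \<le> C\<^sub>c * (real k * loglog (real N / (real k * ln (real k / \<delta>)))
                          + real k * loglog (real k / \<delta>))}
        \<ge> 1 - \<delta> * (C\<^sub>p * loglog (real N)))"
proof (intro exI conjI allI impI)
  fix k N :: nat and \<mu> :: "nat pmf" and \<delta> :: real
  assume asm: "1 \<le> k \<and> 1 \<le> N \<and> set_pmf \<mu> \<subseteq> {1..k} \<and> 0 < \<delta> \<and> \<delta> < 1"
  then have k: "1 \<le> k" and N: "1 \<le> N" and \<mu>: "set_pmf \<mu> \<subseteq> {1..k}" and \<delta>: "0 < \<delta>" "\<delta> < 1"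
    by auto
  define K where "K = real k * ln (real k / \<delta>)"
  define w where "w = loglog (real N / K)"
  define v where "v = loglog (real k / \<delta>)"
  define run where "run = stc_slk_kwn_dst k \<delta> \<mu> N"
  \<comment> \<open>14 covers both the \<open>4 * w\<close> static rounds and the
    \<open>14 * v\<close> others; 70 is 14 times the \<open>5 * k\<close> messages of a round, per
    player.\<close>
  define good where "good = {xs. real (rounds (run xs)) \<le> 14 * (w + v) \<and>
    real (msgs (run xs)) \<le> 70 * (real k * w + real k * v)}"
  have L: "0 < ln (real k / \<delta>)" using L_pos[OF k \<delta> \<mu>] .
  have K: "0 < K" using k L by (simp add: K_def)
  have w: "1 \<le> w" and v: "1 \<le> v" by (simp_all add: w_def v_def loglog_ge_1)
  have "1 - \<delta> * (4 * loglog (real N)) \<le> measure_pmf.prob (replicate_pmf N \<mu>) good"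
  proof (cases "\<delta> < 1 / 4")
    case False \<comment> \<open>then the claimed lower bound is not positive\<close>
    then have "1 \<le> \<delta> * (4 * loglog (real N))"
      using mult_mono[of "1 / 4" \<delta> 4 "4 * loglog (real N)"] loglog_ge_1[of "real N"] \<delta> by simp
    then show ?thesis by (smt (verit) measure_nonneg)
  next
    case True
    \<comment> \<open>Since 4 exceeds \<open>exp 1\<close>, this makes \<open>K \<ge> 1\<close>, so
      \<open>loglog (N / K)\<close> is at most the \<open>loglog N\<close> of the failure
      probability.\<close>
    have "4 \<le> real k / \<delta>" using True k \<delta> by (simp add: pos_le_divide_eq)
    then have "1 \<le> ln (real k / \<delta>)"
      using exp_le by (subst ln_ge_iff) auto
    then have "1 \<le> K" using k mult_mono[of 1 "real k" 1 "ln (real k / \<delta>)"] by (simp add: K_def)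
    have wN: "w \<le> loglog (real N)"
      unfolding w_def using K \<open>1 \<le> K\<close> N by (intro loglog_mono) (auto simp: pos_divide_le_eq)
    \<comment> \<open>The least \<open>j\<close> for which \<open>N / K \<le> 2 ^ (2 ^ j)\<close> is
      guaranteed; rounding up costs at most 1, hence at most \<open>w\<close>.\<close>
    define j where "j = nat \<lceil>3 * w\<rceil>"
    have j: "3 * w \<le> real j" "real j \<le> 4 * w" using w by (auto simp: j_def) linarith
    define st where "st = \<lparr>phase = Static, thr = N, cnt = (\<lambda>_. 0), reported = (\<lambda>_. 0), notif = 0,
      rounds = 0, msgs = 0\<rparr>"
    define bad where "bad = {xs. real (rounds st) + real j + nonstatic_rounds k \<delta> < real (rounds (run xs))}"
    have "(sqrt 2)\<^sup>2 \<le> (sqrt 2 + 2 / 3 :: real)\<^sup>2" by (intro power_mono) auto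
    then have c: "1 \<le> (sqrt 2 + 2 / 3 :: real)\<^sup>2" by simp
    have "real N = 1 * K * (real N / K)" using K by simp
    also have "\<dots> \<le> (sqrt 2 + 2 / 3)\<^sup>2 * K * 2 ^ (2 ^ j)"
      using c K N le_double_power_loglog[of "real N / K" j] j(1)
      by (intro mult_mono) (auto simp: w_def)
    finally have "measure_pmf.prob (replicate_pmf N \<mu>) bad \<le> real j * \<delta>"
      using prob_rounds_le[OF k \<delta> \<mu>, of st j] N
      by (simp add: bad_def run_def stc_slk_kwn_dst_def st_def K_def)
    also have "\<dots> \<le> 4 * loglog (real N) * \<delta>"
      using j(2) wN \<delta> by (intro mult_right_mono) auto
    finally have bad: "measure_pmf.prob (replicate_pmf N \<mu>) bad \<le> \<delta> * (4 * loglog (real N))"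
      by (simp add: mult_ac)
    have "1 - measure_pmf.prob (replicate_pmf N \<mu>) bad = measure_pmf.prob (replicate_pmf N \<mu>) (- bad)"
      using measure_pmf.prob_compl[of bad "replicate_pmf N \<mu>"] by (simp add: Compl_eq_Diff_UNIV)
    also have "\<dots> \<le> measure_pmf.prob (replicate_pmf N \<mu>) good"
    proof (intro measure_pmf.finite_measure_mono_AE AE_pmfI impI)
      fix xs assume "xs \<in> set_pmf (replicate_pmf N \<mu>)" and "xs \<in> - bad"
      then have xs: "set xs \<subseteq> {1..k}" "length xs = N"
          and "real (rounds (run xs)) \<le> real j + nonstatic_rounds k \<delta>"
        using \<mu> by (auto simp: set_replicate_pmf lists_eq_set bad_def st_def)
      then have r: "real (rounds (run xs)) \<le> 14 * (w + v)"
        using j(2) w nonstatic_rounds_le[OF L] k \<delta> by (simp add: v_def)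
      have "real (msgs (run xs)) \<le> real (5 * k * rounds (run xs))"
        using msgs_stc_slk_kwn_dst_le[OF k \<delta> \<mu> N xs] unfolding run_def of_nat_le_iff .
      also have "\<dots> \<le> 5 * real k * (14 * (w + v))"
        using r by (simp add: mult_left_mono)
      finally show "xs \<in> good" using r by (simp add: good_def algebra_simps)
    qed auto
    finally show ?thesis using bad by linarith
  qed
  then show "1 - \<delta> * (4 * loglog (real N)) \<le> measure_pmf.prob (replicate_pmf N \<mu>)
      {xs. real (rounds (stc_slk_kwn_dst k \<delta> \<mu> N xs))
             \<le> 14 * (loglog (real N / (real k * ln (real k / \<delta>))) + loglog (real k / \<delta>)) \<and>
           real (msgs (stc_slk_kwn_dst k \<delta> \<mu> N xs))
             \<le> 70 * (real k * loglog (real N / (real k * ln (real k / \<delta>)))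
                      + real k * loglog (real k / \<delta>))}"
    unfolding good_def run_def w_def v_def K_def .
qed auto

end
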